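(* There is a constant $c>0$ such that for every $n \ge 2$, every top-view caterpillar with $n$ vertices has a planar L-shaped drawing, respecting its prescribed cyclic edge orders, on any set of $c\, n \log n$ points in the plane in general orthogonal position.
   Context: A point set is in general orthogonal position if no two of its points share the same $x$-coordinate or the same $y$-coordinate. Points are unlabelled: the vertices are placed at distinct points of the set, with any vertex allowed at any point (not all points need be used). A planar L-shaped drawing is such a placement in which each edge is drawn as an orthogonal path consisting of one horizontal and one vertical segment (one bend), and no two edges intersect except at a common endpoint. A caterpillar is a tree such that deleting its leaves yields a path, the spine. The tree is ordered: at each vertex a cyclic order of incident edges is prescribed, and the drawing must realize these cyclic orders. A top-view caterpillar is an ordered caterpillar in which each spine vertex is adjacent to two leaves and these two leaves lie on opposite sides of the spine (i.e., in the prescribed cyclic order at each spine vertex the two leaf edges are separated by the spine edges). *)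

theory Defs
  imports "HOL-Analysis.Analysis"
begin

section \<open>Graphs, trees, caterpillars\<close>

text \<open>Vertices are natural numbers from a finite set V; edges are 2-element sets.\<close>

definition simple_graph :: "nat set \<Rightarrow> nat set set \<Rightarrow> bool" where
  "simple_graph V E \<longleftrightarrow> finite V \<and> (\<forall>e\<in>E. \<exists>u v. e = {u, v} \<and> u \<noteq> v \<and> u \<in> V \<and> v \<in> V)"

definition adj :: "nat set set \<Rightarrow> nat \<Rightarrow> nat \<Rightarrow> bool" where
  "adj E u v \<longleftrightarrow> u \<noteq> v \<and> {u, v} \<in> E"

definition nbrs :: "nat set set \<Rightarrow> nat \<Rightarrow> nat set" where
  "nbrs E v = {u. adj E v u}"

definition degree :: "nat set set \<Rightarrow> nat \<Rightarrow> nat" where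
  "degree E v = card (nbrs E v)"

definition connected_graph :: "nat set \<Rightarrow> nat set set \<Rightarrow> bool" where
  "connected_graph V E \<longleftrightarrow> V \<noteq> {} \<and>
     (\<forall>u\<in>V. \<forall>v\<in>V. (u, v) \<in> {(x, y). adj E x y}\<^sup>*)"

text \<open>A cycle: at least 3 distinct vertices, consecutive ones adjacent, last adjacent to first.\<close>
definition is_cycle :: "nat set set \<Rightarrow> nat list \<Rightarrow> bool" where
  "is_cycle E cs \<longleftrightarrow> length cs \<ge> 3 \<and> distinct cs \<and>
     (\<forall>i < length cs. adj E (cs ! i) (cs ! ((i + 1) mod length cs)))"

definition is_tree :: "nat set \<Rightarrow> nat set set \<Rightarrow> bool" where
  "is_tree V E \<longleftrightarrow> simple_graph V E \<and> connected_graph V E \<and> (\<nexists>cs. is_cycle E cs)"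

definition leaves :: "nat set \<Rightarrow> nat set set \<Rightarrow> nat set" where
  "leaves V E = {v \<in> V. degree E v = 1}"

definition spine :: "nat set \<Rightarrow> nat set set \<Rightarrow> nat set" where
  "spine V E = V - leaves V E"

text \<open>The subgraph induced by S is a path with vertex sequence ps.\<close>
definition induced_path :: "nat set set \<Rightarrow> nat set \<Rightarrow> nat list \<Rightarrow> bool" where
  "induced_path E S ps \<longleftrightarrow> ps \<noteq> [] \<and> distinct ps \<and> set ps = S \<and>
     {e \<in> E. e \<subseteq> S} = {{ps ! i, ps ! (i + 1)} | i. i + 1 < length ps}"

definition caterpillar :: "nat set \<Rightarrow> nat set set \<Rightarrow> bool" where
  "caterpillar V E \<longleftrightarrow> is_tree V E \<and> (\<exists>ps. induced_path E (spine V E) ps)"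

section \<open>Ordered trees (rotation systems)\<close>

text \<open>rot v lists the neighbours of v in their prescribed cyclic (counterclockwise) order,
  read up to rotation.\<close>
definition ordered_tree :: "nat set \<Rightarrow> nat set set \<Rightarrow> (nat \<Rightarrow> nat list) \<Rightarrow> bool" where
  "ordered_tree V E rot \<longleftrightarrow> is_tree V E \<and>
     (\<forall>v\<in>V. distinct (rot v) \<and> set (rot v) = nbrs E v)"

text \<open>In the cyclic list xs, the elements a and b are separated by the set B:
  both open arcs of the cycle between a and b contain an element of B.\<close>
definition arc :: "nat list \<Rightarrow> nat \<Rightarrow> nat \<Rightarrow> nat list" where
  "arc xs a b = (let k = (SOME k. k < length xs \<and> rotate k xs \<noteq> [] \<and> hd (rotate k xs) = a)
                 in takeWhile (\<lambda>y. y \<noteq> b) (tl (rotate k xs)))"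

definition separated :: "nat list \<Rightarrow> nat set \<Rightarrow> nat \<Rightarrow> nat \<Rightarrow> bool" where
  "separated xs B a b \<longleftrightarrow> (\<exists>x\<in>B. x \<in> set (arc xs a b)) \<and> (\<exists>x\<in>B. x \<in> set (arc xs b a))"

definition top_view_caterpillar :: "nat set \<Rightarrow> nat set set \<Rightarrow> (nat \<Rightarrow> nat list) \<Rightarrow> bool" where
  "top_view_caterpillar V E rot \<longleftrightarrow> caterpillar V E \<and> ordered_tree V E rot \<and>
     (\<forall>s\<in>spine V E.
        card (nbrs E s \<inter> leaves V E) = 2 \<and>
        (card (nbrs E s \<inter> spine V E) = 2 \<longrightarrow>
           (\<forall>l1 l2. l1 \<in> nbrs E s \<inter> leaves V E \<longrightarrow> l2 \<in> nbrs E s \<inter> leaves V E \<longrightarrow> l1 \<noteq> l2 \<longrightarrow>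
              separated (rot s) (nbrs E s \<inter> spine V E) l1 l2)))"

section \<open>Point sets and planar L-shaped drawings\<close>

definition general_orthogonal_position :: "(real \<times> real) set \<Rightarrow> bool" where
  "general_orthogonal_position P \<longleftrightarrow>
     (\<forall>p\<in>P. \<forall>q\<in>P. p \<noteq> q \<longrightarrow> fst p \<noteq> fst q \<and> snd p \<noteq> snd q)"

text \<open>p places the vertices; bp u v is the bend point of the edge {u,v}.\<close>
definition edge_curve :: "(nat \<Rightarrow> real \<times> real) \<Rightarrow> (nat \<Rightarrow> nat \<Rightarrow> real \<times> real) \<Rightarrow> nat \<Rightarrow> nat \<Rightarrow> (real \<times> real) set" where
  "edge_curve p bp u v = closed_segment (p u) (bp u v) \<union> closed_segment (bp u v) (p v)"

text \<open>Direction in which the edge to u leaves v: 0 = right, 1 = up, 2 = left, 3 = down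
  (counterclockwise order).\<close>
definition port_dir :: "(nat \<Rightarrow> real \<times> real) \<Rightarrow> (nat \<Rightarrow> nat \<Rightarrow> real \<times> real) \<Rightarrow> nat \<Rightarrow> nat \<Rightarrow> nat" where
  "port_dir p bp v u = (let w = bp v u - p v in
     if fst w > 0 then 0 else if snd w > 0 then 1 else if fst w < 0 then 2 else 3)"

definition planar_L_drawing ::
  "nat set \<Rightarrow> nat set set \<Rightarrow> (nat \<Rightarrow> nat list) \<Rightarrow> (real \<times> real) set \<Rightarrow>
   (nat \<Rightarrow> real \<times> real) \<Rightarrow> (nat \<Rightarrow> nat \<Rightarrow> real \<times> real) \<Rightarrow> bool" where
  "planar_L_drawing V E rot P p bp \<longleftrightarrow>
     inj_on p V \<and> p ` V \<subseteq> P \<and>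
     (\<forall>u v. adj E u v \<longrightarrow> bp u v = bp v u \<and>
        bp u v \<in> {(fst (p u), snd (p v)), (fst (p v), snd (p u))}) \<and>
     (\<forall>u v w z. adj E u v \<longrightarrow> adj E w z \<longrightarrow> {u, v} \<noteq> {w, z} \<longrightarrow>
        edge_curve p bp u v \<inter> edge_curve p bp w z \<subseteq> p ` ({u, v} \<inter> {w, z})) \<and>
     (\<forall>v\<in>V. \<exists>k. sorted_wrt (<) (map (port_dir p bp v) (rotate k (rot v))))"

end

theory Submission
  imports Defs
begin

text \<open>Sort the points by \<open>x\<close>-coordinate and cut them into consecutive triples. The \<open>y\<close>-median of a
  triple can carry a spine vertex that the spine passes horizontally, with the two other points
  of the triple as its leaves. Two triples with medians \<open>a\<close> and \<open>a'\<close> can be linked if some points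
  \<open>l\<close>, \<open>b\<close>, \<open>r\<close> lie between them in \<open>x\<close>-order such that \<open>l\<close> and \<open>b\<close> are above \<open>a\<close> while \<open>b\<close> and \<open>r\<close>
  are below \<open>a'\<close>, or the same upside down: then \<open>b\<close> carries a spine vertex passed vertically, with
  leaves \<open>l\<close> and \<open>r\<close>. The spine is \<open>x\<close>-monotone, and the leaf edges of different spine vertices lie in
  disjoint vertical slabs, so that nothing crosses. Five triples whose medians are monotone in \<open>y\<close> always contain a linked pair, so
  by Erdos and Szekeres any 17 triples do. Sorting \<open>m\<close> triples into levels by the longest chain of
  links that ends in them gives levels of size at most 16, hence a chain of length \<open>m / 16\<close>. So a
  linear number of points suffices.\<close>

section \<open>Chains in sequences of points\<close>

text \<open>The classical level argument: the elements whose longest chain has exactly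
  \<open>l\<close> links contain no \<open>R\<close>-related pair, so there are at most
  \<open>s\<close> of them, and \<open>L\<close> levels cannot exhaust \<open>W\<close>.
  \<open>R\<close> need not be transitive, since only neighbours on the chain have to be
  related.\<close>

lemma chain_if_independent_small:
  fixes W :: "nat set"
  assumes "finite W"
    and dep: "\<And>X. X \<subseteq> W \<Longrightarrow> card X = Suc s \<Longrightarrow> \<exists>i\<in>X. \<exists>j\<in>X. i < j \<and> R i j"
    and "card W > s * L"
  shows "\<exists>f::nat \<Rightarrow> nat. (\<forall>i\<le>L. f i \<in> W) \<and> (\<forall>i j. i < j \<longrightarrow> j \<le> L \<longrightarrow> f i < f j) \<and>
    (\<forall>i<L. R (f i) (f (Suc i)))"
proof -
  define ch where "ch f l e \<longleftrightarrow> (\<forall>i\<le>l. f i \<in> W) \<and> (\<forall>i j. i < j \<longrightarrow> j \<le> l \<longrightarrow> f i < f j) \<and>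
    (\<forall>i<l. R (f i) (f (Suc i))) \<and> f l = e" for f :: "nat \<Rightarrow> nat" and l e
  define T where "T l = {e\<in>W. \<exists>f. ch f l e}" for l
  have fin: "finite (T l)" for l
    using assms(1) by (auto simp: T_def)
  \<comment> \<open>No two elements of \<open>T l - T (Suc l)\<close> are related, so each step loses at most \<open>s\<close> elements.\<close>
  have "card W \<le> card (T l) + s * l" for l
  proof (induction l)
    case 0
    have "e \<in> T 0" if "e \<in> W" for e
      unfolding T_def using that by (auto intro!: exI[of _ "\<lambda>_. e"] simp: ch_def)
    then have "T 0 = W" by (auto simp: T_def)
    then show ?case by simp
  next
    case (Suc l)
    have ind: "\<not> R i j" if ij: "i \<in> T l - T (Suc l)" "j \<in> T l - T (Suc l)" "i < j" for i j
    proof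
      assume R: "R i j"
      obtain f where f: "ch f l i" using ij by (auto simp: T_def)
      have "ch (f(Suc l := j)) (Suc l) j"
        unfolding ch_def
      proof (intro conjI allI impI)
        fix a b assume "a < b" "b \<le> Suc l"
        moreover have "f a < j" if "a \<le> l"
        proof -
          have "a = l \<or> f a < f l" "f l = i" using le_neq_implies_less[OF that] f by (auto simp: ch_def)
          then show ?thesis using ij(3) by auto
        qed
        ultimately show "(f(Suc l := j)) a < (f(Suc l := j)) b"
          using f unfolding ch_def by (cases "b = Suc l") auto
      qed (use f ij R in \<open>auto simp: ch_def T_def le_Suc_eq less_Suc_eq\<close>)
      then have "j \<in> T (Suc l)" using ij by (auto simp: T_def)
      then show False using ij by simp
    qed
    have "card (T l - T (Suc l)) \<le> s"
    proof (rule ccontr)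
      assume "\<not> ?thesis"
      then obtain X where X: "X \<subseteq> T l - T (Suc l)" "card X = Suc s"
        by (metis not_less_eq_eq obtain_subset_with_card_n)
      moreover have "X \<subseteq> W" using X by (auto simp: T_def)
      ultimately show False using dep[of X] ind by blast
    qed
    moreover have "card (T l) \<le> card (T l - T (Suc l)) + card (T (Suc l))"
      by (metis card_Un_le card_mono fin finite_Diff finite_UnI Un_Diff_cancel2 Un_upper1 order.trans)
    ultimately show ?case using Suc by simp
  qed
  from this[of L] have "T L \<noteq> {}" using assms(3) by auto
  then show ?thesis by (auto simp: T_def ch_def)
qed

text \<open>Either any \<open>Suc s\<close> indices in \<open>W\<close> include an increasing pair,
  and the level argument with \<open>L = s\<close> yields a long increasing sequence, or some
  \<open>Suc s\<close> of them include none, and sorting these by index gives a decreasing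
  one.\<close>

lemma erdos_szekeres:
  fixes y :: "nat \<Rightarrow> 'a::linorder"
  assumes "finite W" "inj_on y W" "card W > s * s"
  shows "\<exists>f::nat \<Rightarrow> nat. (\<forall>i\<le>s. f i \<in> W) \<and> (\<forall>i j. i < j \<longrightarrow> j \<le> s \<longrightarrow> f i < f j) \<and>
    ((\<forall>i<s. y (f i) < y (f (Suc i))) \<or> (\<forall>i<s. y (f i) > y (f (Suc i))))"
proof (cases "\<forall>X. X \<subseteq> W \<longrightarrow> card X = Suc s \<longrightarrow> (\<exists>i\<in>X. \<exists>j\<in>X. i < j \<and> y i < y j)")
  case True
  then show ?thesis
    using chain_if_independent_small[OF assms(1), of s "\<lambda>i j. y i < y j" s] assms(3) by blast
next
  case False
  then obtain X where X: "X \<subseteq> W" "card X = Suc s"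
      and dec: "\<And>i j. i \<in> X \<Longrightarrow> j \<in> X \<Longrightarrow> i < j \<Longrightarrow> \<not> y i < y j" by blast
  have finX: "finite X" using X by (metis assms(1) finite_subset)
  define f where "f i = sorted_list_of_set X ! i" for i
  have len: "length (sorted_list_of_set X) = Suc s" using X by simp
  have fX: "f i \<in> X" if "i \<le> s" for i
    using that len finX unfolding f_def by (metis le_imp_less_Suc nth_mem set_sorted_list_of_set)
  have mono: "f i < f j" if "i < j" "j \<le> s" for i j
    using that len unfolding f_def
    by (metis le_imp_less_Suc sorted_wrt_nth_less strict_sorted_list_of_set)
  have "y (f i) > y (f (Suc i))" if "i < s" for i
  proof -
    have a: "f i \<in> X" "f (Suc i) \<in> X" "f i < f (Suc i)" using that fX mono by auto
    then have "y (f i) \<noteq> y (f (Suc i))"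
      using X(1) assms(2) by (metis inj_on_eq_iff less_irrefl subsetD)
    then show ?thesis using dec[OF a] by simp
  qed
  then show ?thesis using fX X(1) mono by blast
qed

section \<open>Sorted points and the choice of indices for the vertices\<close>

lemma enumerate_by_x:
  assumes "finite P" "general_orthogonal_position P"
  shows "\<exists>q. (\<forall>i<card P. q i \<in> P) \<and> (\<forall>i j. i < j \<longrightarrow> j < card P \<longrightarrow> fst (q i) < fst (q j)) \<and>
    inj_on (\<lambda>i. snd (q i)) {..<card P}"
proof -
  have inj: "inj_on fst P" "inj_on snd P"
    using assms(2) unfolding general_orthogonal_position_def inj_on_def by blast+
  define xs where "xs = sorted_list_of_set (fst ` P)"
  define q where "q i = the_inv_into P fst (xs ! i)" for i
  have len: "length xs = card P" by (simp add: xs_def card_image inj)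
  have xs: "xs ! i \<in> fst ` P" if "i < card P" for i
    using that len assms(1) unfolding xs_def by (metis finite_imageI nth_mem set_sorted_list_of_set)
  have q: "q i \<in> P" "fst (q i) = xs ! i" if "i < card P" for i
    using the_inv_into_into[OF inj(1) xs[OF that] order.refl] f_the_inv_into_f[OF inj(1) xs[OF that]]
    by (simp_all add: q_def)
  have less: "fst (q i) < fst (q j)" if "i < j" "j < card P" for i j
  proof -
    have "xs ! i < xs ! j"
      using that len sorted_wrt_nth_less[OF strict_sorted_list_of_set[of "fst ` P"]] unfolding xs_def by simp
    then show ?thesis using q that by simp
  qed
  have "inj_on (\<lambda>i. snd (q i)) {..<card P}"
  proof (rule inj_onI)
    fix i j assume ij: "i \<in> {..<card P}" "j \<in> {..<card P}" "snd (q i) = snd (q j)"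
    then have "q i = q j" using inj_onD[OF inj(2)] q by simp
    then show "i = j" using less[of i j] less[of j i] ij by (cases i j rule: linorder_cases) auto
  qed
  then show ?thesis using q less by blast
qed

lemma exists_median:
  fixes y :: "nat \<Rightarrow> real"
  assumes "inj_on y {n, n + 1, n + 2}"
  shows "\<exists>d m u. {d, m, u} \<subseteq> {n..n + 2} \<and> y d < y m \<and> y m < y u"
proof -
  have "y n \<noteq> y (n + 1)" "y n \<noteq> y (n + 2)" "y (n + 1) \<noteq> y (n + 2)"
    using assms by (auto simp: inj_on_def)
  then consider "y n < y (n+1)" "y (n+1) < y (n+2)" | "y n < y (n+2)" "y (n+2) < y (n+1)"
    | "y (n+1) < y n" "y n < y (n+2)" | "y (n+1) < y (n+2)" "y (n+2) < y n"
    | "y (n+2) < y n" "y n < y (n+1)" | "y (n+2) < y (n+1)" "y (n+1) < y n" by linarith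
  then show ?thesis
  proof cases
    case 1 then show ?thesis by (intro exI[of _ n] exI[of _ "n+1"] exI[of _ "n+2"]) auto
  next
    case 2 then show ?thesis by (intro exI[of _ n] exI[of _ "n+2"] exI[of _ "n+1"]) auto
  next
    case 3 then show ?thesis by (intro exI[of _ "n+1"] exI[of _ n] exI[of _ "n+2"]) auto
  next
    case 4 then show ?thesis by (intro exI[of _ "n+1"] exI[of _ "n+2"] exI[of _ n]) auto
  next
    case 5 then show ?thesis by (intro exI[of _ "n+2"] exI[of _ n] exI[of _ "n+1"]) auto
  next
    case 6 then show ?thesis by (intro exI[of _ "n+2"] exI[of _ "n+1"] exI[of _ n]) auto
  qed
qed

text \<open>Position \<open>(i, Spine)\<close> stands for the \<open>i\<close>-th spine vertex, and \<open>First\<close>, \<open>Second\<close> are its leaves in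
  the counterclockwise order: previous spine vertex, \<open>First\<close>, next spine vertex, \<open>Second\<close>.\<close>
datatype role = Spine | First | Second

text \<open>The spine passes vertically through vertex \<open>i\<close>, upwards in the first case and downwards in the
  second one. The last two conditions keep the two leaves off the horizontal parts of the
  spine edges at \<open>i\<close>.\<close>
definition vertical_passage :: "(nat \<times> role \<Rightarrow> 'a::linorder) \<Rightarrow> (nat \<times> role \<Rightarrow> real) \<Rightarrow> nat \<Rightarrow> bool" where
  "vertical_passage x y i \<longleftrightarrow>
    x (i, Second) < x (i, Spine) \<and> x (i, Spine) < x (i, First) \<and>
    y (i - 1, Spine) < y (i, Spine) \<and> y (i, Spine) < y (Suc i, Spine) \<and>
    y (i - 1, Spine) < y (i, Second) \<and> y (i, First) < y (Suc i, Spine) \<or>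
    x (i, First) < x (i, Spine) \<and> x (i, Spine) < x (i, Second) \<and>
    y (i - 1, Spine) > y (i, Spine) \<and> y (i, Spine) > y (Suc i, Spine) \<and>
    y (i - 1, Spine) > y (i, First) \<and> y (i, Second) > y (Suc i, Spine)"

text \<open>Even spine vertices occupy whole triples of indices, odd ones the gaps between the
  triples of a chain. The bound on \<open>N\<close> makes room for \<open>16 * L + 1\<close>
  triples, hence for a chain of \<open>L\<close> links. By \<open>k \<le> 2 * L\<close> a triple
  follows each odd vertex, also the last one, whose condition mentions \<open>Suc i\<close>.\<close>

lemma exists_index_layout:
  fixes y :: "nat \<Rightarrow> real"
  assumes inj: "inj_on y {..<N}" and N: "N \<ge> 3 * (16 * L + 1)" and k: "k \<le> 2 * L"
  shows "\<exists>idx lo hi. (\<forall>i<k. \<forall>r. lo i \<le> idx (i, r) \<and> idx (i, r) \<le> hi i \<and> hi i < N) \<and>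
    (\<forall>i j. i < j \<longrightarrow> j < k \<longrightarrow> hi i < (lo j :: nat)) \<and>
    (\<forall>i<k. even i \<longrightarrow> y (idx (i, First)) < y (idx (i, Spine)) \<and> y (idx (i, Spine)) < y (idx (i, Second))) \<and>
    (\<forall>i<k. odd i \<longrightarrow> vertical_passage idx (y \<circ> idx) i)"
proof -
  define W where "W = {..<16 * L + 1}"
  have "\<exists>d m u. {d, m, u} \<subseteq> {3 * t..3 * t + 2} \<and> y d < y m \<and> y m < y u" if "t \<in> W" for t
    using that N by (intro exists_median inj_on_subset[OF inj]) (auto simp: W_def)
  then obtain D M U where tri: "{D t, M t, U t} \<subseteq> {3 * t..3 * t + 2}" "y (D t) < y (M t)" "y (M t) < y (U t)"
    if "t \<in> W" for t by metis
  have M: "3 * t \<le> M t" "M t \<le> 3 * t + 2" "M t < N" if "t \<in> W" for t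
    using tri(1)[OF that] that N by (auto simp: W_def)
  \<comment> \<open>\<open>g\<close>, \<open>b\<close>, \<open>h\<close> are to become
    \<open>First\<close>, \<open>Spine\<close>, \<open>Second\<close> of the vertical vertex between
    the triples \<open>t\<close> and \<open>t'\<close>; the two alternatives are those of
    \<open>vertical_passage\<close>.\<close>
  define ok where "ok t t' g b h \<longleftrightarrow>
      3 * t + 2 < min g h \<and> max g h < 3 * t' \<and>
      (h < b \<and> b < g \<and> y (M t) < y b \<and> y b < y (M t') \<and> y (M t) < y h \<and> y g < y (M t') \<or>
       g < b \<and> b < h \<and> y (M t) > y b \<and> y b > y (M t') \<and> y (M t) > y g \<and> y h > y (M t'))"
    for t t' g b h
  \<comment> \<open>Among 17 triples, five have monotone medians; the inner three of these link the outer two.\<close>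
  have "\<exists>f. (\<forall>i\<le>L. f i \<in> W) \<and> (\<forall>i j. i < j \<longrightarrow> j \<le> L \<longrightarrow> f i < f j) \<and>
      (\<forall>i<L. \<exists>g b h. ok (f i) (f (Suc i)) g b h)"
  proof (rule chain_if_independent_small[where s = 16])
    fix X assume X: "X \<subseteq> W" "card X = Suc 16"
    have "inj_on (\<lambda>t. y (M t)) X"
    proof (rule inj_onI)
      fix t t' assume a: "t \<in> X" "t' \<in> X" "y (M t) = y (M t')"
      then have "M t = M t'" using inj_onD[OF inj] M(3) X by (meson lessThan_iff subsetD)
      then show "t = t'" using M[of t] M[of t'] a X by force
    qed
    then obtain f where f: "\<forall>i\<le>4. f i \<in> X" "\<forall>i j. i < j \<longrightarrow> j \<le> 4 \<longrightarrow> f i < f j"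
      "(\<forall>i<4. y (M (f i)) < y (M (f (Suc i)))) \<or> (\<forall>i<4. y (M (f i)) > y (M (f (Suc i))))"
      using erdos_szekeres[of X "\<lambda>t. y (M t)" 4] X card.infinite[of X] by fastforce
    have W: "f 0 \<in> W" "f 1 \<in> W" "f 2 \<in> W" "f 3 \<in> W" "f 4 \<in> W" using f(1) X(1) by auto
    have less: "f 0 < f 1" "f 1 < f 2" "f 2 < f 3" "f 3 < f 4" using f(2) by auto
    note Ms = M(1,2)[OF W(2)] M(1,2)[OF W(3)] M(1,2)[OF W(4)]
    from f(3) consider
        "y (M (f 0)) < y (M (f 1))" "y (M (f 1)) < y (M (f 2))" "y (M (f 2)) < y (M (f 3))" "y (M (f 3)) < y (M (f 4))"
      | "y (M (f 0)) > y (M (f 1))" "y (M (f 1)) > y (M (f 2))" "y (M (f 2)) > y (M (f 3))" "y (M (f 3)) > y (M (f 4))"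
      by (simp add: numeral_eq_Suc All_less_Suc) blast
    then have "\<exists>g b h. ok (f 0) (f 4) g b h"
    proof cases
      case 1
      \<comment> \<open>On an ascent the spine passes upwards, so \<open>Second\<close> has to be on
        its left and \<open>First\<close> on its right.\<close>
      then have "ok (f 0) (f 4) (M (f 3)) (M (f 2)) (M (f 1))"
        unfolding ok_def using less Ms by auto
      then show ?thesis by blast
    next
      case 2
      then have "ok (f 0) (f 4) (M (f 1)) (M (f 2)) (M (f 3))"
        unfolding ok_def using less Ms by auto
      then show ?thesis by blast
    qed
    then show "\<exists>i\<in>X. \<exists>j\<in>X. i < j \<and> (\<exists>g b h. ok i j g b h)"
      using f by (intro bexI[of _ "f 0"] bexI[of _ "f 4"]) auto
  qed (auto simp: W_def)
  then obtain f where f: "\<And>i. i \<le> L \<Longrightarrow> f i \<in> W" "\<And>i j. i < j \<Longrightarrow> j \<le> L \<Longrightarrow> f i < f j"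
      and "\<forall>i<L. \<exists>g b h. ok (f i) (f (Suc i)) g b h" by blast
  then obtain g b h where ok: "ok (f i) (f (Suc i)) (g i) (b i) (h i)" if "i < L" for i by metis
  \<comment> \<open>\<open>i div 2\<close> numbers the triple, or the link that follows it. In a
    triple \<open>First\<close> is the lowest point: counterclockwise, the downward port comes after
    the one to the previous spine vertex on the left.\<close>
  define idx where "idx = (\<lambda>(i, r). let j = i div 2 in
     if even i then (case r of Spine \<Rightarrow> M (f j) | First \<Rightarrow> D (f j) | Second \<Rightarrow> U (f j))
     else (case r of Spine \<Rightarrow> b j | First \<Rightarrow> g j | Second \<Rightarrow> h j))"
  define lo where "lo i = (if even i then 3 * f (i div 2) else 3 * f (i div 2) + 3)" for i
  define hi where "hi i = (if even i then 3 * f (i div 2) + 2 else 3 * f (Suc (i div 2)) - 1)" for i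
  have bound: "3 * f j + 2 < N" if "j \<le> L" for j using f(1)[OF that] N by (auto simp: W_def)
  have cell: "lo i \<le> idx (i, r) \<and> idx (i, r) \<le> hi i \<and> hi i < N" if "i < k" for i r
  proof (cases "even i")
    case True
    then obtain j where j: "i = 2 * j" by (elim evenE)
    then have "j \<le> L" using that k by simp
    then have t: "{D (f j), M (f j), U (f j)} \<subseteq> {3 * f j..3 * f j + 2}" "3 * f j + 2 < N"
      using tri(1) f(1) bound by blast+
    show ?thesis using t by (cases r) (simp_all add: j idx_def lo_def hi_def)
  next
    case False
    then obtain j where j: "i = Suc (2 * j)" by (auto elim: oddE)
    then have jL: "j < L" using that k by simp
    then have "3 * f (Suc j) + 2 < N" using bound[of "Suc j"] by simp
    then show ?thesis using ok[OF jL]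
      by (cases r) (auto simp: j idx_def lo_def hi_def ok_def)
  qed
  have cells: "hi i < lo j" if ij: "i < j" "j < k" for i j
  proof -
    have j: "j div 2 \<le> L" using ij k by auto
    have "even i \<and> i div 2 < j div 2 \<or> even i \<and> i div 2 = j div 2 \<and> odd j \<or>
        odd i \<and> Suc (i div 2) = j div 2 \<or> odd i \<and> Suc (i div 2) < j div 2"
      using ij(1) by presburger
    then consider "even i" "i div 2 < j div 2" | "even i" "i div 2 = j div 2" "odd j"
      | "odd i" "Suc (i div 2) = j div 2" | "odd i" "Suc (i div 2) < j div 2"
      by blast
    then show ?thesis
    proof cases
      case 1 then show ?thesis using f(2)[OF 1(2) j] by (auto simp: lo_def hi_def)
    next
      case 2 then show ?thesis by (auto simp: lo_def hi_def)
    next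
      case 3
      \<comment> \<open>This makes \<open>f (j div 2)\<close> positive, so that the subtraction in
        \<open>hi\<close> is not truncated.\<close>
      then have "f (i div 2) < f (j div 2)" using f(2)[of "i div 2" "j div 2"] j by auto
      then show ?thesis using 3 by (auto simp: lo_def hi_def)
    next
      case 4
      then show ?thesis using f(2)[OF 4(2) j] by (auto simp: lo_def hi_def)
    qed
  qed
  have ev: "y (idx (i, First)) < y (idx (i, Spine)) \<and> y (idx (i, Spine)) < y (idx (i, Second))"
    if "i < k" "even i" for i
    using that k tri(2,3)[OF f(1), of "i div 2"] by (auto simp: idx_def)
  have od: "vertical_passage idx (y \<circ> idx) i" if i: "i < k" "odd i" for i
  proof -
    obtain j where j: "i = Suc (2 * j)" using i(2) by (auto elim: oddE)
    have "j < L" using i k j by auto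
    from ok[OF this] show ?thesis by (auto simp: j idx_def ok_def vertical_passage_def)
  qed
  show ?thesis using cell cells ev od by blast
qed

section \<open>Planarity of the layout\<close>

definition hv_curve :: "real \<times> real \<Rightarrow> real \<times> real \<Rightarrow> (real \<times> real) set" where
  "hv_curve a b = closed_segment a (fst b, snd a) \<union> closed_segment (fst b, snd a) b"

text \<open>All crossing arguments below see the curves only through these inequalities, which turns
  planarity into linear arithmetic.\<close>

lemma hv_curveD:
  assumes "z \<in> hv_curve a b"
  shows "snd z = snd a \<and> (fst a \<le> fst z \<and> fst z \<le> fst b \<or> fst b \<le> fst z \<and> fst z \<le> fst a) \<or>
    fst z = fst b \<and> (snd a \<le> snd z \<and> snd z \<le> snd b \<or> snd b \<le> snd z \<and> snd z \<le> snd a)"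
proof -
  obtain z1 z2 a1 a2 b1 b2 where eqs: "z = (z1, z2)" "a = (a1, a2)" "b = (b1, b2)"
    by (cases z, cases a, cases b)
  have "(z1, z2) \<in> closed_segment (a1, a2) (b1, a2) \<or> (z1, z2) \<in> closed_segment (b1, a2) (b1, b2)"
    using assms by (simp add: hv_curve_def eqs)
  then have "z1 \<in> closed_segment a1 b1 \<and> z2 \<in> closed_segment a2 a2 \<or>
        z1 \<in> closed_segment b1 b1 \<and> z2 \<in> closed_segment a2 b2"
    by (blast dest: closed_segment_PairD)
  then show ?thesis
    unfolding closed_segment_eq_real_ivl eqs fst_conv snd_conv
    by (auto split: if_split_asm)
qed

text \<open>\<open>hedge x y\<close>: the edge between positions \<open>x\<close> and \<open>y\<close> leaves \<open>x\<close> horizontally and \<open>y\<close> vertically.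
  The spine passes horizontally through the even spine vertices, vertically through the odd ones.\<close>
inductive hedge :: "nat \<times> role \<Rightarrow> nat \<times> role \<Rightarrow> bool" where
  "even i \<Longrightarrow> hedge (i, Spine) (Suc i, Spine)"
| "odd i \<Longrightarrow> hedge (Suc i, Spine) (i, Spine)"
| "even i \<Longrightarrow> r \<noteq> Spine \<Longrightarrow> hedge (i, r) (i, Spine)"
| "odd i \<Longrightarrow> r \<noteq> Spine \<Longrightarrow> hedge (i, Spine) (i, r)"

text \<open>This makes the bend point of an edge independent of the order in which its ends are
  named.\<close>

lemma hedge_asym: "hedge x y \<Longrightarrow> \<not> hedge y x"
  by (rule notI, erule hedge.cases; erule hedge.cases; simp)

text \<open>The interface between the choice of points and planarity: a spine vertex and its two
  leaves share the vertical strip from \<open>lo i\<close> to \<open>hi i\<close>. For odd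
  \<open>i = k - 1\<close>, \<open>odd_cell\<close> mentions position \<open>k\<close>, which
  carries no vertex but still has coordinates.\<close>

locale caterpillar_layout =
  fixes k :: nat and pos :: "nat \<times> role \<Rightarrow> real \<times> real" and lo hi :: "nat \<Rightarrow> real"
  assumes cell: "i < k \<Longrightarrow> lo i \<le> fst (pos (i, r)) \<and> fst (pos (i, r)) \<le> hi i"
    and cells: "i < j \<Longrightarrow> j < k \<Longrightarrow> hi i < lo j"
    and even_cell: "i < k \<Longrightarrow> even i \<Longrightarrow>
      snd (pos (i, First)) < snd (pos (i, Spine)) \<and> snd (pos (i, Spine)) < snd (pos (i, Second))"
    and odd_cell: "i < k \<Longrightarrow> odd i \<Longrightarrow> vertical_passage (fst \<circ> pos) (snd \<circ> pos) i"
begin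

lemmas odd_cell_cases = odd_cell[unfolded vertical_passage_def comp_def]

lemma fst_less: "i < j \<Longrightarrow> j < k \<Longrightarrow> fst (pos (i, r)) < fst (pos (j, s))"
  by (meson cell cells order.strict_trans order_le_less_trans order_less_le_trans)

text \<open>Strips separate different indices; inside a strip the roles differ in height if
  \<open>i\<close> is even and in \<open>x\<close>-coordinate if \<open>i\<close> is odd.\<close>

lemma inj_on_pos: "inj_on pos ({..<k} \<times> UNIV)"
proof (rule inj_onI)
  fix x y assume "x \<in> {..<k} \<times> UNIV" "y \<in> {..<k} \<times> UNIV" and eq: "pos x = pos y"
  then obtain i r j s where xy: "x = (i, r)" "y = (j, s)" "i < k" "j < k" by auto
  have ij: "i = j"
    using fst_less[of i j r s] fst_less[of j i s r] eq xy by (cases i j rule: linorder_cases) auto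
  have "r = s"
  proof (cases "even i")
    case True
    then show ?thesis using even_cell[OF xy(3)] eq xy ij by (cases r; cases s) auto
  next
    case False
    then show ?thesis using odd_cell_cases[OF xy(3)] eq xy ij by (cases r; cases s) auto
  qed
  with ij xy show "x = y" by simp
qed

definition spine_curve :: "nat \<Rightarrow> (real \<times> real) set" where
  "spine_curve i = (if even i then hv_curve (pos (i, Spine)) (pos (Suc i, Spine))
     else hv_curve (pos (Suc i, Spine)) (pos (i, Spine)))"

definition leaf_curve :: "nat \<Rightarrow> role \<Rightarrow> (real \<times> real) set" where
  "leaf_curve i r = (if even i then hv_curve (pos (i, r)) (pos (i, Spine))
     else hv_curve (pos (i, Spine)) (pos (i, r)))"

text \<open>Spine vertices are ordered by \<open>x\<close>, so an edge lies between the
  \<open>x\<close>-coordinates of its ends. It leaves its even end horizontally, so its vertical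
  part lies at the \<open>x\<close>-coordinate of the odd end.\<close>

lemma spine_curveD:
  assumes "z \<in> spine_curve i" "Suc i < k"
  shows "fst (pos (i, Spine)) \<le> fst z" "fst z \<le> fst (pos (Suc i, Spine))"
    and "even i \<Longrightarrow> snd z = snd (pos (i, Spine)) \<or> fst z = fst (pos (Suc i, Spine)) \<and>
      (snd (pos (i, Spine)) \<le> snd z \<and> snd z \<le> snd (pos (Suc i, Spine)) \<or>
       snd (pos (Suc i, Spine)) \<le> snd z \<and> snd z \<le> snd (pos (i, Spine)))"
    and "odd i \<Longrightarrow> snd z = snd (pos (Suc i, Spine)) \<or> fst z = fst (pos (i, Spine)) \<and>
      (snd (pos (i, Spine)) \<le> snd z \<and> snd z \<le> snd (pos (Suc i, Spine)) \<or>
       snd (pos (Suc i, Spine)) \<le> snd z \<and> snd z \<le> snd (pos (i, Spine)))"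
proof -
  have less: "fst (pos (i, Spine)) < fst (pos (Suc i, Spine))" using fst_less assms(2) by simp
  have ev: "even i \<Longrightarrow> z \<in> hv_curve (pos (i, Spine)) (pos (Suc i, Spine))"
    and od: "odd i \<Longrightarrow> z \<in> hv_curve (pos (Suc i, Spine)) (pos (i, Spine))"
    using assms(1) by (simp_all add: spine_curve_def)
  show "fst (pos (i, Spine)) \<le> fst z" "fst z \<le> fst (pos (Suc i, Spine))"
    using hv_curveD[OF ev] hv_curveD[OF od] less by argo+
  show "snd z = snd (pos (i, Spine)) \<or> fst z = fst (pos (Suc i, Spine)) \<and>
      (snd (pos (i, Spine)) \<le> snd z \<and> snd z \<le> snd (pos (Suc i, Spine)) \<or>
       snd (pos (Suc i, Spine)) \<le> snd z \<and> snd z \<le> snd (pos (i, Spine)))" if "even i"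
    using hv_curveD[OF ev[OF that]] by argo
  show "snd z = snd (pos (Suc i, Spine)) \<or> fst z = fst (pos (i, Spine)) \<and>
      (snd (pos (i, Spine)) \<le> snd z \<and> snd z \<le> snd (pos (Suc i, Spine)) \<or>
       snd (pos (Suc i, Spine)) \<le> snd z \<and> snd z \<le> snd (pos (i, Spine)))" if "odd i"
    using hv_curveD[OF od[OF that]] by argo
qed

text \<open>The bend takes its \<open>x\<close>-coordinate from one of the ends, so the edge stays
  in the strip of its spine vertex. Its vertical part is at the spine vertex if \<open>i\<close> is
  even and at the leaf if \<open>i\<close> is odd.\<close>

lemma leaf_curveD:
  assumes "z \<in> leaf_curve i r" "i < k"
  shows "lo i \<le> fst z" "fst z \<le> hi i"
    and "even i \<Longrightarrow> snd z = snd (pos (i, r)) \<or> fst z = fst (pos (i, Spine)) \<and>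
      (snd (pos (i, Spine)) \<le> snd z \<and> snd z \<le> snd (pos (i, r)) \<or>
       snd (pos (i, r)) \<le> snd z \<and> snd z \<le> snd (pos (i, Spine)))"
    and "odd i \<Longrightarrow> snd z = snd (pos (i, Spine)) \<and>
      (fst (pos (i, Spine)) \<le> fst z \<and> fst z \<le> fst (pos (i, r)) \<or>
       fst (pos (i, r)) \<le> fst z \<and> fst z \<le> fst (pos (i, Spine))) \<or>
      fst z = fst (pos (i, r)) \<and>
      (snd (pos (i, Spine)) \<le> snd z \<and> snd z \<le> snd (pos (i, r)) \<or>
       snd (pos (i, r)) \<le> snd z \<and> snd z \<le> snd (pos (i, Spine)))"
proof -
  note c = cell[OF assms(2), of r] cell[OF assms(2), of Spine]
  have ev: "even i \<Longrightarrow> z \<in> hv_curve (pos (i, r)) (pos (i, Spine))"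
    and od: "odd i \<Longrightarrow> z \<in> hv_curve (pos (i, Spine)) (pos (i, r))"
    using assms(1) by (simp_all add: leaf_curve_def)
  show "lo i \<le> fst z" "fst z \<le> hi i"
    using hv_curveD[OF ev] hv_curveD[OF od] c by argo+
  show "snd z = snd (pos (i, r)) \<or> fst z = fst (pos (i, Spine)) \<and>
      (snd (pos (i, Spine)) \<le> snd z \<and> snd z \<le> snd (pos (i, r)) \<or>
       snd (pos (i, r)) \<le> snd z \<and> snd z \<le> snd (pos (i, Spine)))" if "even i"
    using hv_curveD[OF ev[OF that]] by argo
  show "snd z = snd (pos (i, Spine)) \<and>
      (fst (pos (i, Spine)) \<le> fst z \<and> fst z \<le> fst (pos (i, r)) \<or>
       fst (pos (i, r)) \<le> fst z \<and> fst z \<le> fst (pos (i, Spine))) \<or>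
      fst z = fst (pos (i, r)) \<and>
      (snd (pos (i, Spine)) \<le> snd z \<and> snd z \<le> snd (pos (i, r)) \<or>
       snd (pos (i, r)) \<le> snd z \<and> snd z \<le> snd (pos (i, Spine)))" if "odd i"
    using hv_curveD[OF od[OF that]] by argo
qed

text \<open>By \<open>x\<close>-monotonicity only consecutive edges can meet, and only at the
  \<open>x\<close>-coordinate of their common vertex. If \<open>j\<close> is even, they arrive there
  horizontally from opposite sides; if \<open>j\<close> is odd, vertically, one from below and one
  from above.\<close>

lemma spine_spine:
  assumes "i < j" "Suc j < k" "z \<in> spine_curve i" "z \<in> spine_curve j"
  shows "j = Suc i \<and> z = pos (j, Spine)"
proof -
  have i: "Suc i < k" using assms by simp
  have le: "fst (pos (j, Spine)) \<le> fst z" "fst z \<le> fst (pos (Suc i, Spine))"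
    using spine_curveD(1)[OF assms(4,2)] spine_curveD(2)[OF assms(3) i] by simp_all
  have j: "j = Suc i"
  proof (rule ccontr)
    assume "j \<noteq> Suc i"
    then have "fst (pos (Suc i, Spine)) < fst (pos (j, Spine))" using fst_less assms(1,2) by simp
    then show False using le by simp
  qed
  have z: "fst z = fst (pos (j, Spine))" using le j by simp
  have less: "fst (pos (i, Spine)) < fst (pos (j, Spine))" "fst (pos (j, Spine)) < fst (pos (Suc j, Spine))"
    using fst_less assms(1,2) by simp_all
  have "snd z = snd (pos (j, Spine))"
  proof (cases "even i")
    case True
    then have o: "odd j" "j < k" "j - 1 = i" using j assms by auto
    show ?thesis
      using spine_curveD(3)[OF assms(3) i True] spine_curveD(4)[OF assms(4,2) o(1)]
        odd_cell_cases[OF o(2,1)] z less o(3) j by (smt (verit))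
  next
    case False
    then have o: "even j" using j by auto
    show ?thesis
      using spine_curveD(4)[OF assms(3) i False] spine_curveD(3)[OF assms(4,2) o] z less j
      by (smt (verit))
  qed
  then show ?thesis using j z by (simp add: prod_eq_iff)
qed

text \<open>Different strips are disjoint. Within one strip the two leaf edges leave in opposite
  directions, down and up for even \<open>i\<close>, to the two sides for odd
  \<open>i\<close>.\<close>

lemma leaf_leaf:
  assumes "i < k" "j < k" "r \<noteq> Spine" "s \<noteq> Spine" "(i, r) \<noteq> (j, s)"
    "z \<in> leaf_curve i r" "z \<in> leaf_curve j s"
  shows "i = j \<and> z = pos (i, Spine)"
proof -
  have ij: "i = j"
    using leaf_curveD(1,2)[OF assms(6,1)] leaf_curveD(1,2)[OF assms(7,2)]
      cells[of i j] cells[of j i] assms(1,2)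
    by (cases i j rule: linorder_cases) simp_all
  have z: "z \<in> leaf_curve i First" "z \<in> leaf_curve i Second"
    using assms(3-7) ij by (cases r; cases s; simp)+
  have "fst z = fst (pos (i, Spine)) \<and> snd z = snd (pos (i, Spine))"
  proof (cases "even i")
    case True
    show ?thesis
      using leaf_curveD(3)[OF z(1) assms(1) True] leaf_curveD(3)[OF z(2) assms(1) True]
        even_cell[OF assms(1) True] by (smt (verit))
  next
    case False
    show ?thesis
      using leaf_curveD(4)[OF z(1) assms(1) False] leaf_curveD(4)[OF z(2) assms(1) False]
        odd_cell_cases[OF assms(1) False] by (smt (verit))
  qed
  with ij show ?thesis by (simp add: prod_eq_iff)
qed

text \<open>The strips leave only the two ends of the spine edge. In the strip of the even end the
  edge is horizontal, and leaf edges have that height only at the spine vertex. At the odd end it is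
  vertical up to the height of the even end, which the leaf on that side does not reach by the last
  two conditions of \<open>vertical_passage\<close>.\<close>

lemma spine_leaf:
  assumes "Suc i < k" "j < k" "s \<noteq> Spine" "z \<in> spine_curve i" "z \<in> leaf_curve j s"
  shows "(j = i \<or> j = Suc i) \<and> z = pos (j, Spine)"
proof -
  note fz = spine_curveD(1,2)[OF assms(4,1)] leaf_curveD(1,2)[OF assms(5,2)]
  have i: "i < k" using assms(1) by simp
  have j: "j = i \<or> j = Suc i"
  proof (rule ccontr)
    assume "\<not> ?thesis"
    then consider "j < i" | "Suc i < j" by linarith
    then show False
    proof cases
      case 1
      then show False using fz cells[OF 1 i] cell[OF i, of Spine] by simp
    next
      case 2
      then show False using fz cells[OF 2 assms(2)] cell[OF assms(1), of Spine] by simp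
    qed
  qed
  have less: "fst (pos (i, Spine)) < fst (pos (Suc i, Spine))" "fst (pos (i, s)) < fst (pos (Suc i, Spine))"
      "fst (pos (i, Spine)) < fst (pos (Suc i, s))" "hi i < lo (Suc i)"
    using fst_less cells assms(1) by simp_all
  note c = cell[OF i, of Spine] cell[OF assms(1), of Spine]
  have s: "s = First \<or> s = Second" using assms(3) by (cases s) auto
  from j have "fst z = fst (pos (j, Spine)) \<and> snd z = snd (pos (j, Spine))"
  proof
    assume ji: "j = i"
    note zs = assms(5)[unfolded ji]
    show ?thesis
    proof (cases "even i")
      case True
      show ?thesis
        using even_cell[OF i True] s less fz(1,2) fz(3,4)[unfolded ji] c
          spine_curveD(3)[OF assms(4,1) True] leaf_curveD(3)[OF zs i True]
        unfolding ji by (smt (verit))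
    next
      case False
      show ?thesis
        using odd_cell_cases[OF i False] s less fz(1,2) fz(3,4)[unfolded ji] c
          spine_curveD(4)[OF assms(4,1) False] leaf_curveD(4)[OF zs i False]
        unfolding ji by (smt (verit))
    qed
  next
    assume ji: "j = Suc i"
    note zs = assms(5)[unfolded ji]
    show ?thesis
    proof (cases "even i")
      case True
      then have o: "odd (Suc i)" by simp
      show ?thesis
        using odd_cell_cases[OF assms(1) o, unfolded diff_Suc_1] s less fz(1,2) fz(3,4)[unfolded ji] c
          spine_curveD(3)[OF assms(4,1) True] leaf_curveD(4)[OF zs assms(1) o]
        unfolding ji by (smt (verit))
    next
      case False
      then have o: "even (Suc i)" by simp
      show ?thesis
        using even_cell[OF assms(1) o] s less fz(1,2) fz(3,4)[unfolded ji] c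
          spine_curveD(4)[OF assms(4,1) False] leaf_curveD(3)[OF zs assms(1) o]
        unfolding ji by (smt (verit))
    qed
  qed
  with j show ?thesis by (simp add: prod_eq_iff)
qed

lemma hedge_cases:
  assumes "hedge x y" "x \<in> {..<k} \<times> UNIV" "y \<in> {..<k} \<times> UNIV"
  obtains (spine) i where "Suc i < k" "{x, y} = {(i, Spine), (Suc i, Spine)}"
      "hv_curve (pos x) (pos y) = spine_curve i"
  | (leaf) i r where "i < k" "r \<noteq> Spine" "{x, y} = {(i, Spine), (i, r)}"
      "hv_curve (pos x) (pos y) = leaf_curve i r"
  using assms(1)
proof (cases rule: hedge.cases)
  case (1 i)
  show ?thesis by (rule spine[of i]) (use 1 assms(3) in \<open>simp_all add: spine_curve_def\<close>)
next
  case (2 i)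
  show ?thesis by (rule spine[of i]) (use 2 assms(2) in \<open>simp_all add: spine_curve_def insert_commute\<close>)
next
  case (3 i r)
  show ?thesis by (rule leaf[of i r]) (use 3 assms(2) in \<open>simp_all add: leaf_curve_def insert_commute\<close>)
next
  case (4 i r)
  show ?thesis by (rule leaf[of i r]) (use 4 assms(2) in \<open>simp_all add: leaf_curve_def\<close>)
qed

lemma hv_curves_disjoint:
  assumes "hedge x y" "x \<in> {..<k} \<times> UNIV" "y \<in> {..<k} \<times> UNIV"
    and "hedge x' y'" "x' \<in> {..<k} \<times> UNIV" "y' \<in> {..<k} \<times> UNIV"
    and ne: "{x, y} \<noteq> {x', y'}"
    and z: "z \<in> hv_curve (pos x) (pos y)" "z \<in> hv_curve (pos x') (pos y')"
  shows "z \<in> pos ` ({x, y} \<inter> {x', y'})"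
  using assms(1-3)
proof (cases rule: hedge_cases)
  case s: (spine i)
  note zs = z(1)[unfolded s(3)]
  show ?thesis using assms(4-6)
  proof (cases rule: hedge_cases)
    case t: (spine j)
    note zt = z(2)[unfolded t(3)]
    have "i < j \<or> j < i" using s(2) t(2) ne by (metis linorder_neqE_nat)
    then show ?thesis
      using spine_spine[OF _ t(1) zs zt] spine_spine[OF _ s(1) zt zs]
      unfolding s(2) t(2) by (elim disjE) auto
  next
    case t: (leaf j r)
    show ?thesis using spine_leaf[OF s(1) t(1,2) zs z(2)[unfolded t(4)]] unfolding s(2) t(3) by auto
  qed
next
  case s: (leaf i r)
  note zs = z(1)[unfolded s(4)]
  show ?thesis using assms(4-6)
  proof (cases rule: hedge_cases)
    case t: (spine j)
    show ?thesis using spine_leaf[OF t(1) s(1,2) z(2)[unfolded t(3)] zs] unfolding s(3) t(2) by auto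
  next
    case t: (leaf j r')
    have "(i, r) \<noteq> (j, r')" using s(3) t(3) ne by auto
    from leaf_leaf[OF s(1) t(1) s(2) t(2) this zs z(2)[unfolded t(4)]]
    show ?thesis unfolding s(3) t(3) by auto
  qed
qed

end

section \<open>The structure of top-view caterpillars\<close>

lemma rotate_to_front:
  assumes "x \<in> set xs"
  shows "\<exists>m ys. rotate m xs = x # ys"
proof -
  obtain us vs where "xs = us @ x # vs" using split_list[OF assms] by blast
  then have "rotate (length us) xs = x # (vs @ us)" by (simp add: rotate_append)
  then show ?thesis by blast
qed

text \<open>As the entries are distinct, only one shift below \<open>length xs\<close> brings
  \<open>a\<close> to the front, so the choice in \<open>arc\<close> is determined; \<open>b\<close>
  then stops the arc at once.\<close>

lemma arc_adjacent:
  assumes "distinct xs" "rotate m xs = a # b # ys"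
  shows "arc xs a b = []"
proof -
  have ne: "xs \<noteq> []" using assms(2) by auto
  define k where "k = m mod length xs"
  have k: "k < length xs" "rotate k xs = a # b # ys"
    using ne assms(2) by (simp_all add: k_def flip: rotate_conv_mod)
  have "(SOME k. k < length xs \<and> rotate k xs \<noteq> [] \<and> hd (rotate k xs) = a) = k"
  proof (rule some_equality)
    fix n assume n: "n < length xs \<and> rotate n xs \<noteq> [] \<and> hd (rotate n xs) = a"
    then have "xs ! n = a" using hd_rotate_conv_nth[OF ne, of n] by force
    moreover have "xs ! k = a" using hd_rotate_conv_nth[OF ne, of k] k by simp
    ultimately show "n = k" using n k assms(1) by (metis nth_eq_iff_index_eq)
  qed (use k in simp)
  then show ?thesis using k by (simp add: arc_def)
qed

lemma not_separated_if_adjacent: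
  assumes "distinct xs" "rotate m xs = a # b # ys"
  shows "\<not> separated xs B a b" "\<not> separated xs B b a"
  using arc_adjacent[OF assms] by (simp_all add: separated_def)

lemma distinct_doubleton_cases: "distinct ys \<Longrightarrow> set ys = {a, b} \<Longrightarrow> a \<noteq> b \<Longrightarrow> ys = [a, b] \<or> ys = [b, a]"
proof -
  assume a: "distinct ys" "set ys = {a, b}" "a \<noteq> b"
  then have "length ys = 2" by (metis card_2_iff distinct_card)
  then obtain c d where "ys = [c, d]" by (auto simp: length_Suc_conv numeral_2_eq_2)
  then show ?thesis using a by (auto simp: doubleton_eq_iff)
qed

text \<open>\<open>bs\<close> and \<open>as\<close> hold the previous and the next spine neighbour,
  if any. With at most one of them, every cyclic order has the desired form after a suitable naming
  of \<open>F\<close> and \<open>G\<close>. With both, separation forbids the leaves to be cyclic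
  neighbours, so they alternate with the spine neighbours.\<close>

lemma rotation_with_two_leaves:
  fixes xs :: "nat list"
  assumes dist: "distinct xs" and set: "set xs = {l1, l2} \<union> set bs \<union> set as" and "l1 \<noteq> l2"
    and "l1 \<notin> set (bs @ as)" "l2 \<notin> set (bs @ as)" "distinct (bs @ as)"
    and bs: "bs = [] \<or> (\<exists>p. bs = [p])" and as: "as = [] \<or> (\<exists>n. as = [n])"
    and sep: "bs \<noteq> [] \<Longrightarrow> as \<noteq> [] \<Longrightarrow> separated xs (set bs \<union> set as) l1 l2"
  shows "\<exists>F G m. {F, G} = {l1, l2} \<and> F \<noteq> G \<and> rotate m xs = bs @ [F] @ as @ [G]"
proof -
  have sub: "distinct ys \<and> set ys = set xs - {x}" if "rotate m xs = x # ys" for m x ys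
    using that dist by (metis Diff_insert_absorb distinct.simps(2) distinct_rotate list.simps(15) set_rotate)
  consider "bs = []" "as = []" | p where "bs = [p]" "as = []" | n where "bs = []" "as = [n]"
    | p n where "bs = [p]" "as = [n]" using bs as by blast
  then show ?thesis
  proof cases
    case 1
    obtain m ys where m: "rotate m xs = l1 # ys" using rotate_to_front[of l1 xs] set by auto
    then have "distinct ys \<and> set ys = {l2}" using sub[OF m] set 1 assms(3) by auto
    then have "ys = [l2]"
      by (metis distinct_card card_1_singleton_iff One_nat_def length_0_conv length_Suc_conv list.set_intros(1) singletonD)
    then show ?thesis using m 1 assms(3) by (intro exI[of _ l1] exI[of _ l2] exI[of _ m]) auto
  next
    case (2 p)
    obtain m ys where m: "rotate m xs = p # ys" using rotate_to_front[of p xs] set 2 by auto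
    then have "distinct ys \<and> set ys = {l1, l2}" using sub[OF m] set 2 assms(4,5) by auto
    then have "ys = [l1, l2] \<or> ys = [l2, l1]" using distinct_doubleton_cases assms(3) by metis
    then show ?thesis using m 2 assms(3) by (metis append_Cons append_Nil insert_commute)
  next
    case (3 n)
    obtain m ys where m: "rotate m xs = n # ys" using rotate_to_front[of n xs] set 3 by auto
    then have "distinct ys \<and> set ys = {l1, l2}" using sub[OF m] set 3 assms(4,5) by auto
    then have "ys = [l1, l2] \<or> ys = [l2, l1]" using distinct_doubleton_cases assms(3) by metis
    then obtain F G where FG: "ys = [G, F]" "{F, G} = {l1, l2}" "F \<noteq> G"
      using assms(3) by (metis insert_commute)
    \<comment> \<open>The list was read from \<open>n\<close>, while the target begins with
      \<open>F\<close>, the last of the three entries.\<close>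
    have "rotate (2 + m) xs = rotate 2 (rotate m xs)" by (simp only: rotate_rotate)
    also have "\<dots> = [F, n, G]" using m FG by (simp add: numeral_2_eq_2)
    finally have "rotate (2 + m) xs = bs @ [F] @ as @ [G]" using 3 by simp
    with FG show ?thesis by blast
  next
    case (4 p n)
    obtain m ys where m: "rotate m xs = p # ys" using rotate_to_front[of p xs] set 4 by auto
    have ys: "distinct ys" "set ys = {l1, l2, n}" using sub[OF m] set 4 assms(4-6) by auto
    have "card {l1, l2, n} = 3" using 4 assms(3-6) by auto
    then have "length ys = 3" using ys distinct_card by metis
    then obtain x y z where xyz: "ys = [x, y, z]" by (auto simp: length_Suc_conv numeral_3_eq_3)
    \<comment> \<open>These rotations put \<open>x, y\<close> and \<open>y, z\<close> in front, so
      that neither pair can be the two separated leaves.\<close>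
    have r1: "rotate (1 + m) xs = [x, y, z, p]" and r2: "rotate (2 + m) xs = [y, z, p, x]"
      using m xyz by (simp_all add: numeral_2_eq_2 flip: rotate_rotate)
    have s: "separated xs (set bs \<union> set as) l1 l2" using sep 4 by simp
    have "x \<noteq> n"
    proof
      assume "x = n"
      then have "{y, z} = {l1, l2}" using ys xyz 4 assms(4,5) by auto
      then show False using not_separated_if_adjacent[OF dist r2] s by (auto simp: doubleton_eq_iff)
    qed
    moreover have "z \<noteq> n"
    proof
      assume "z = n"
      then have "{x, y} = {l1, l2}" using ys xyz 4 assms(4,5) by auto
      then show False using not_separated_if_adjacent[OF dist r1] s by (auto simp: doubleton_eq_iff)
    qed
    ultimately have yn: "y = n" using ys xyz by auto
    have "{x, z} = {l1, l2}" "x \<noteq> z" using yn ys xyz 4 assms(4,5) by auto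
    moreover have "rotate m xs = bs @ [x] @ as @ [z]" using m xyz yn 4 by simp
    ultimately show ?thesis by blast
  qed
qed

section \<open>Leaves, spine and the labelling of vertices by positions\<close>

lemma adj_sym: "adj E u v \<longleftrightarrow> adj E v u"
  by (auto simp: adj_def insert_commute)

lemma adj_in_vertices: "simple_graph V E \<Longrightarrow> adj E u v \<Longrightarrow> u \<in> V \<and> v \<in> V"
  unfolding simple_graph_def adj_def by (metis doubleton_eq_iff)

lemma leaf_nbrs: "u \<in> leaves V E \<Longrightarrow> adj E u w \<Longrightarrow> nbrs E u = {w}"
  by (auto simp: leaves_def degree_def nbrs_def card_1_singleton_iff set_eq_iff)

text \<open>Two adjacent leaves would form a whole component, and by connectivity there would be no
  spine vertex \<open>s\<close>.\<close>

lemma leaf_adj_spine: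
  assumes "is_tree V E" "u \<in> leaves V E" "adj E u w" "s \<in> spine V E"
  shows "w \<in> spine V E"
proof (rule ccontr)
  assume "w \<notin> spine V E"
  then have w: "w \<in> leaves V E"
    using assms(1,3) adj_in_vertices by (auto simp: spine_def is_tree_def)
  have closed: "y \<in> {u, w}" if "x \<in> {u, w}" "adj E x y" for x y
    using that leaf_nbrs[OF assms(2,3)] leaf_nbrs[OF w] assms(3) adj_sym[of E u w]
    by (auto simp: nbrs_def set_eq_iff)
  have "(u, s) \<in> {(x, y). adj E x y}\<^sup>*"
    using assms by (auto simp: is_tree_def connected_graph_def leaves_def spine_def)
  then have "s \<in> {u, w}"
    by (induction rule: rtrancl_induct) (use closed in \<open>auto\<close>)
  then show False using assms(2,4) w by (auto simp: spine_def)
qed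

text \<open>The standard reading of the rotation at \<open>(i, Spine)\<close>, with missing spine
  neighbours skipped at the ends of the spine.\<close>

definition spine_star :: "nat \<Rightarrow> nat \<Rightarrow> (nat \<times> role) list" where
  "spine_star k i = (if i = 0 then [] else [(i - 1, Spine)]) @ [(i, First)] @
     (if Suc i < k then [(Suc i, Spine)] else []) @ [(i, Second)]"

lemma induced_path_adj:
  assumes "induced_path E S ps" "i < length ps" "j < length ps"
  shows "adj E (ps ! i) (ps ! j) \<longleftrightarrow> j = Suc i \<or> i = Suc j"
proof -
  have path: "distinct ps" "set ps = S"
      "{e \<in> E. e \<subseteq> S} = {{ps ! i, ps ! (i + 1)} | i. i + 1 < length ps}"
    using assms(1) by (auto simp: induced_path_def)
  have "{ps ! i, ps ! j} \<subseteq> S" using path(2) assms by auto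
  then have "{ps ! i, ps ! j} \<in> E \<longleftrightarrow> {ps ! i, ps ! j} \<in> {e \<in> E. e \<subseteq> S}" by simp
  also have "\<dots> \<longleftrightarrow> (\<exists>l. Suc l < length ps \<and> {ps ! i, ps ! j} = {ps ! l, ps ! Suc l})"
    unfolding path(3) by auto
  also have "\<dots> \<longleftrightarrow> (\<exists>l. Suc l < length ps \<and> (i = l \<and> j = Suc l \<or> i = Suc l \<and> j = l))"
    using assms(2,3) path(1) by (intro ex_cong1) (auto simp: doubleton_eq_iff nth_eq_iff_index_eq)
  also have "\<dots> \<longleftrightarrow> j = Suc i \<or> i = Suc j" using assms by auto
  finally show ?thesis using assms path(1) by (auto simp: adj_def nth_eq_iff_index_eq)
qed

text \<open>The abstract tree is reduced to positions, on which adjacency and rotations have a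
  standard form. Which leaf is \<open>First\<close> is read off from the rotation at each spine
  vertex separately.\<close>

lemma top_view_caterpillar_structure:
  assumes tv: "top_view_caterpillar V E rot"
  obtains k \<phi> where "bij_betw \<phi> ({..<k} \<times> UNIV) V"
    and "\<And>x y. x \<in> {..<k} \<times> UNIV \<Longrightarrow> y \<in> {..<k} \<times> UNIV \<Longrightarrow> adj E (\<phi> x) (\<phi> y) \<Longrightarrow> hedge x y \<or> hedge y x"
    and "\<And>i. i < k \<Longrightarrow> \<exists>m. rotate m (rot (\<phi> (i, Spine))) = map \<phi> (spine_star k i)"
    and "\<And>i r. i < k \<Longrightarrow> r \<noteq> Spine \<Longrightarrow> length (rot (\<phi> (i, r))) = 1"
proof -
  obtain ps where ps: "induced_path E (spine V E) ps"
    using tv by (auto simp: top_view_caterpillar_def caterpillar_def)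
  have tree: "is_tree V E" and simple: "simple_graph V E"
    using tv by (auto simp: top_view_caterpillar_def caterpillar_def is_tree_def)
  have rot: "distinct (rot v)" "set (rot v) = nbrs E v" if "v \<in> V" for v
    using tv that by (auto simp: top_view_caterpillar_def ordered_tree_def)
  define k where "k = length ps"
  have dist: "distinct ps" and set_ps: "set ps = spine V E" and "ps \<noteq> []"
    using ps by (auto simp: induced_path_def)
  have sp: "ps ! i \<in> spine V E" "ps ! i \<in> V" if "i < k" for i
    using that set_ps nth_mem by (auto simp: k_def spine_def)
  define bs where "bs i = (if i = 0 then [] else [ps ! (i - 1)])" for i
  define as where "as i = (if Suc i < k then [ps ! Suc i] else [])" for i
  have spine_nbrs: "nbrs E (ps ! i) \<inter> spine V E = set (bs i) \<union> set (as i)" if i: "i < k" for i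
  proof -
    have "nbrs E (ps ! i) \<inter> spine V E = {ps ! j | j. j < k \<and> (j = Suc i \<or> i = Suc j)}"
    proof (intro set_eqI iffI)
      fix x assume x: "x \<in> nbrs E (ps ! i) \<inter> spine V E"
      then obtain j where "j < k" "x = ps ! j" unfolding set_ps[symmetric] by (auto simp: in_set_conv_nth k_def)
      then show "x \<in> {ps ! j | j. j < k \<and> (j = Suc i \<or> i = Suc j)}"
        using x induced_path_adj[OF ps] i by (auto simp: nbrs_def k_def)
    next
      fix x assume "x \<in> {ps ! j | j. j < k \<and> (j = Suc i \<or> i = Suc j)}"
      then obtain j where "j < k" "x = ps ! j" "j = Suc i \<or> i = Suc j" by blast
      then show "x \<in> nbrs E (ps ! i) \<inter> spine V E"
        using induced_path_adj[OF ps] i sp by (simp add: nbrs_def k_def)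
    qed
    also have "\<dots> = set (bs i) \<union> set (as i)"
      using i by (cases i) (auto simp: bs_def as_def)
    finally show ?thesis .
  qed
  have "\<exists>F G m. nbrs E (ps ! i) \<inter> leaves V E = {F, G} \<and> F \<noteq> G \<and>
      rotate m (rot (ps ! i)) = bs i @ [F] @ as i @ [G]" if i: "i < k" for i
  proof -
    have card2: "card (nbrs E (ps ! i) \<inter> leaves V E) = 2" and
      sep: "card (nbrs E (ps ! i) \<inter> spine V E) = 2 \<Longrightarrow> l1 \<in> nbrs E (ps ! i) \<inter> leaves V E \<Longrightarrow>
        l2 \<in> nbrs E (ps ! i) \<inter> leaves V E \<Longrightarrow> l1 \<noteq> l2 \<Longrightarrow>
        separated (rot (ps ! i)) (nbrs E (ps ! i) \<inter> spine V E) l1 l2" for l1 l2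
      using tv sp[OF i] by (auto simp: top_view_caterpillar_def)
    obtain l1 l2 where l: "nbrs E (ps ! i) \<inter> leaves V E = {l1, l2}" "l1 \<noteq> l2"
      using card2 by (metis card_2_iff)
    have dis: "distinct (bs i @ as i)"
      using dist i by (auto simp: bs_def as_def k_def nth_eq_iff_index_eq)
    have "nbrs E (ps ! i) \<subseteq> V" using adj_in_vertices[OF simple] by (auto simp: nbrs_def)
    then have "nbrs E (ps ! i) = {l1, l2} \<union> (nbrs E (ps ! i) \<inter> spine V E)"
      using l(1) by (auto simp: spine_def)
    then have nb: "set (rot (ps ! i)) = {l1, l2} \<union> set (bs i) \<union> set (as i)"
      using spine_nbrs[OF i] rot(2) sp(2)[OF i] by (simp add: Un_assoc)
    have nin: "l1 \<notin> set (bs i @ as i)" "l2 \<notin> set (bs i @ as i)"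
      using spine_nbrs[OF i] l(1) by (auto simp: spine_def)
    \<comment> \<open>Separation is prescribed only at vertices with two spine neighbours, that is,
      when both lists are nonempty.\<close>
    have "separated (rot (ps ! i)) (set (bs i) \<union> set (as i)) l1 l2" if "bs i \<noteq> []" "as i \<noteq> []"
    proof -
      have "card (set (bs i) \<union> set (as i)) = 2"
        using that distinct_card[OF dis] by (auto simp: bs_def as_def split: if_splits)
      then show ?thesis using sep[of l1 l2] l spine_nbrs[OF i] by auto
    qed
    then have "\<exists>F G m. {F, G} = {l1, l2} \<and> F \<noteq> G \<and> rotate m (rot (ps ! i)) = bs i @ [F] @ as i @ [G]"
      by (intro rotation_with_two_leaves rot(1) sp(2) i nb nin dis l(2)) (auto simp: bs_def as_def)
    then show ?thesis using l(1) by metis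
  qed
  then obtain F G m where FG: "nbrs E (ps ! i) \<inter> leaves V E = {F i, G i}" "F i \<noteq> G i"
      "rotate (m i) (rot (ps ! i)) = bs i @ [F i] @ as i @ [G i]" if "i < k" for i
    by metis
  define \<phi> where "\<phi> = (\<lambda>(i, r). case r of Spine \<Rightarrow> ps ! i | First \<Rightarrow> F i | Second \<Rightarrow> G i)"
  have \<phi>_Spine [simp]: "\<phi> (i, Spine) = ps ! i" for i by (simp add: \<phi>_def)
  have leaf: "\<phi> (i, r) \<in> leaves V E" "nbrs E (\<phi> (i, r)) = {ps ! i}" if "i < k" "r \<noteq> Spine" for i r
  proof -
    have *: "\<phi> (i, r) \<in> nbrs E (ps ! i) \<inter> leaves V E"
      using FG(1)[OF that(1)] that(2) by (cases r) (auto simp: \<phi>_def)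
    then show "\<phi> (i, r) \<in> leaves V E" by simp
    show "nbrs E (\<phi> (i, r)) = {ps ! i}"
      using * leaf_nbrs[of "\<phi> (i, r)" V E "ps ! i"] adj_sym by (auto simp: nbrs_def)
  qed
  have ps_inj: "ps ! i = ps ! j \<longleftrightarrow> i = j" if "i < k" "j < k" for i j
    using that dist by (simp add: k_def nth_eq_iff_index_eq)
  have "inj_on \<phi> ({..<k} \<times> UNIV)"
  proof (rule inj_onI)
    fix x y assume "x \<in> {..<k} \<times> UNIV" "y \<in> {..<k} \<times> UNIV" and eq: "\<phi> x = \<phi> y"
    then obtain i r j s where xy: "x = (i, r)" "y = (j, s)" "i < k" "j < k" by auto
    have spine: "r = Spine \<longleftrightarrow> s = Spine"
      using leaf(1)[OF xy(3), of r] leaf(1)[OF xy(4), of s] sp(1)[OF xy(3)] sp(1)[OF xy(4)] eq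
      unfolding xy(1,2) by (cases "r = Spine"; cases "s = Spine") (auto simp: spine_def)
    have ij: "i = j"
    proof (cases "r = Spine")
      case True then show ?thesis using spine eq xy ps_inj by simp
    next
      case False
      then have "{ps ! i} = {ps ! j}" using spine leaf(2) eq xy by metis
      then show ?thesis using xy ps_inj by simp
    qed
    moreover have "r = s" using eq xy ij spine FG(2)[OF xy(3)] by (cases r; cases s) (auto simp: \<phi>_def)
    ultimately show "x = y" using xy by simp
  qed
  moreover have "\<phi> ` ({..<k} \<times> UNIV) = V"
  proof
    have "\<phi> (i, r) \<in> V" if "i < k" for i r
      using leaf(1)[OF that] sp[OF that] by (cases "r = Spine") (auto simp: leaves_def)
    then show "\<phi> ` ({..<k} \<times> UNIV) \<subseteq> V" by auto
    show "V \<subseteq> \<phi> ` ({..<k} \<times> UNIV)"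
    proof
      fix v assume v: "v \<in> V"
      show "v \<in> \<phi> ` ({..<k} \<times> UNIV)"
      proof (cases "v \<in> spine V E")
        case True
        then obtain i where "i < k" "v = \<phi> (i, Spine)"
          unfolding set_ps[symmetric] by (auto simp: k_def in_set_conv_nth)
        then show ?thesis by blast
      next
        case False
        then have lv: "v \<in> leaves V E" using v by (simp add: spine_def)
        then obtain w where w: "adj E v w"
          by (auto simp: leaves_def degree_def nbrs_def card_1_singleton_iff set_eq_iff)
        have "ps ! 0 \<in> spine V E" using sp(1)[of 0] \<open>ps \<noteq> []\<close> by (simp add: k_def)
        then have "w \<in> spine V E" using leaf_adj_spine[OF tree lv w] by simp
        then obtain i where i: "i < k" "w = ps ! i"
          unfolding set_ps[symmetric] by (auto simp: k_def in_set_conv_nth)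
        then have "v \<in> {F i, G i}" using FG(1)[OF i(1)] lv w adj_sym by (auto simp: nbrs_def)
        then have "v = \<phi> (i, First) \<or> v = \<phi> (i, Second)" by (auto simp: \<phi>_def)
        then show ?thesis using i(1) by blast
      qed
    qed
  qed
  ultimately have bij: "bij_betw \<phi> ({..<k} \<times> UNIV) V" by (simp add: bij_betw_def)
  have edge: "hedge x y \<or> hedge y x"
    if xy: "x \<in> {..<k} \<times> UNIV" "y \<in> {..<k} \<times> UNIV" and "adj E (\<phi> x) (\<phi> y)" for x y
  proof -
    obtain i r j s where ij: "x = (i, r)" "y = (j, s)" "i < k" "j < k" using xy by auto
    have a: "adj E (\<phi> (i, r)) (\<phi> (j, s))" using that(3) ij by simp
    have leaf_case: "t = Spine \<and> i' = j'"
      if "i' < k" "j' < k" "u \<noteq> Spine" "adj E (\<phi> (i', u)) (\<phi> (j', t))" for i' j' u t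
    proof -
      have e: "\<phi> (j', t) = \<phi> (i', Spine)" using leaf(2)[OF that(1,3)] that(4) by (auto simp: nbrs_def)
      have "(j', t) = (i', Spine)"
        by (rule inj_onD[OF bij_betw_imp_inj_on[OF bij] e]) (use that(1,2) in auto)
      then show ?thesis by simp
    qed
    consider "r = Spine" "s = Spine" | "r \<noteq> Spine" | "s \<noteq> Spine" by blast
    then show ?thesis
    proof cases
      case 1
      then have "j = Suc i \<or> i = Suc j" using a induced_path_adj[OF ps] ij by (simp add: k_def)
      then show ?thesis using hedge.intros(1,2) 1 ij by metis
    next
      case 2
      then have "s = Spine \<and> i = j" using leaf_case a ij by blast
      then show ?thesis using hedge.intros(3,4)[of i r] 2 ij by metis
    next
      case 3
      then have "r = Spine \<and> j = i" using leaf_case[of j i s r] a ij adj_sym by blast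
      then show ?thesis using hedge.intros(3,4)[of i s] 3 ij by metis
    qed
  qed
  have star: "\<exists>m. rotate m (rot (\<phi> (i, Spine))) = map \<phi> (spine_star k i)" if "i < k" for i
    using FG(3)[OF that] by (intro exI[of _ "m i"]) (simp add: spine_star_def bs_def as_def \<phi>_def)
  have "length (rot (\<phi> (i, r))) = 1" if "i < k" "r \<noteq> Spine" for i r
    using leaf[OF that] rot[of "\<phi> (i, r)"] distinct_card[of "rot (\<phi> (i, r))"] by (auto simp: leaves_def)
  with bij edge star show thesis using that by blast
qed

section \<open>Drawing the caterpillar\<close>

context caterpillar_layout
begin

text \<open>The direction codes of \<open>port_dir\<close>, expressed by positions alone;
  \<open>hedge x y\<close> tells that the edge starts horizontally at \<open>x\<close>.\<close>

definition port :: "nat \<times> role \<Rightarrow> nat \<times> role \<Rightarrow> nat" where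
  "port x y = (if hedge x y then (if fst (pos x) < fst (pos y) then 0 else 2)
     else (if snd (pos x) < snd (pos y) then 1 else 3))"

lemma hedge_iff:
  "hedge (i, Spine) (j, Spine) \<longleftrightarrow> even i \<and> (j = Suc i \<or> i = Suc j)"
  "r \<noteq> Spine \<Longrightarrow> hedge (i, Spine) (j, r) \<longleftrightarrow> odd i \<and> i = j"
  by (auto elim: hedge.cases intro: hedge.intros)

text \<open>From the previous spine vertex on, the ports of a full star are 2, 3, 0, 1 at an even
  vertex, 3, 0, 1, 2 on an upward passage and 1, 2, 3, 0 on a downward one. These are rotations of
  0, 1, 2, 3, and missing neighbours do not disturb the order.\<close>

lemma ports_sorted:
  assumes i: "i < k"
  shows "\<exists>m. sorted_wrt (<) (map (port (i, Spine)) (rotate m (spine_star k i)))"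
proof -
  have succ: "fst (pos (i, Spine)) < fst (pos (Suc i, Spine))" if "Suc i < k"
    using fst_less that by simp
  have pred: "fst (pos (i - 1, Spine)) < fst (pos (i, Spine))" if "i \<noteq> 0"
    using fst_less[of "i - 1" i] i that by simp
  show ?thesis
  proof (cases "even i")
    case True
    note e = even_cell[OF i True]
    have p: "i \<noteq> 0 \<Longrightarrow> port (i, Spine) (i - 1, Spine) = 2" "port (i, Spine) (i, First) = 3"
        "Suc i < k \<Longrightarrow> port (i, Spine) (Suc i, Spine) = 0" "port (i, Spine) (i, Second) = 1"
      using succ pred e True by (auto simp: port_def hedge_iff)
    \<comment> \<open>The rotation moves the entries with ports 2 and 3 to the back; for
      \<open>i = 0\<close> the only such entry is \<open>First\<close>.\<close>
    show ?thesis
      by (rule exI[of _ "if i = 0 then 1 else 2"]) (use p in \<open>cases "i = 0"; simp add: spine_star_def numeral_2_eq_2\<close>)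
  next
    case False
    then have "i \<noteq> 0" by (intro notI) simp
    from odd_cell_cases[OF i False] show ?thesis
    proof (elim disjE, goal_cases)
      case 1
      then have p: "port (i, Spine) (i - 1, Spine) = 3" "port (i, Spine) (i, First) = 0"
          "port (i, Spine) (Suc i, Spine) = 1" "port (i, Spine) (i, Second) = 2"
        using False by (simp_all add: port_def hedge_iff)
      show ?case
        by (rule exI[of _ 1]) (use p \<open>i \<noteq> 0\<close> in \<open>simp add: spine_star_def\<close>)
    next
      case 2
      then have p: "port (i, Spine) (i - 1, Spine) = 1" "port (i, Spine) (i, First) = 2"
          "port (i, Spine) (Suc i, Spine) = 3" "port (i, Spine) (i, Second) = 0"
        using False by (simp_all add: port_def hedge_iff)
      \<comment> \<open>Port 0 belongs to the last entry, \<open>Second\<close>, at index 3 or,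
        without a next spine vertex, 2.\<close>
      show ?case
        by (rule exI[of _ "if Suc i < k then 3 else 2"])
          (use p \<open>i \<noteq> 0\<close> in \<open>cases "Suc i < k"; simp add: spine_star_def numeral_2_eq_2 numeral_3_eq_3\<close>)
    qed
  qed
qed

text \<open>This excludes a degenerate horizontal start, for which \<open>port_dir\<close> would
  fall through to 3 while \<open>port\<close> gives 2. For vertical starts both give 3 unless the
  edge goes up.\<close>

lemma fst_neq_if_hedge_Spine:
  assumes "hedge (i, Spine) y" "i < k" "y \<in> {..<k} \<times> UNIV"
  shows "fst (pos (i, Spine)) \<noteq> fst (pos y)"
  using assms(1)
proof (cases rule: hedge.cases)
  case 1
  then show ?thesis using fst_less[of i "Suc i" Spine Spine] assms(3) by auto
next
  case (2 j)
  then show ?thesis using fst_less[of j i Spine Spine] assms(2) by auto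
next
  case (4 r)
  then show ?thesis using odd_cell_cases[OF assms(2)] by (cases r) auto
qed simp

lemma spine_star_subset: "i < k \<Longrightarrow> set (spine_star k i) \<subseteq> {..<k} \<times> UNIV"
  by (auto simp: spine_star_def)

text \<open>Pulling vertices back to positions along the inverse \<open>\<psi>\<close> of
  \<open>\<phi>\<close> reduces planarity to \<open>hv_curves_disjoint\<close> and the cyclic orders
  to \<open>ports_sorted\<close>. Injectivity makes common ends of edges correspond to common
  positions.\<close>

lemma planar_L_drawing_exists:
  assumes simple: "simple_graph V E" and P: "pos ` ({..<k} \<times> UNIV) \<subseteq> P"
    and bij: "bij_betw \<phi> ({..<k} \<times> UNIV) V"
    and edge: "\<And>x y. x \<in> {..<k} \<times> UNIV \<Longrightarrow> y \<in> {..<k} \<times> UNIV \<Longrightarrow> adj E (\<phi> x) (\<phi> y) \<Longrightarrow> hedge x y \<or> hedge y x"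
    and star: "\<And>i. i < k \<Longrightarrow> \<exists>m. rotate m (rot (\<phi> (i, Spine))) = map \<phi> (spine_star k i)"
    and leaf: "\<And>i r. i < k \<Longrightarrow> r \<noteq> Spine \<Longrightarrow> length (rot (\<phi> (i, r))) = 1"
  shows "\<exists>p bp. planar_L_drawing V E rot P p bp"
proof -
  let ?D = "{..<k} \<times> (UNIV :: role set)"
  define \<psi> where "\<psi> = the_inv_into ?D \<phi>"
  have bij': "bij_betw \<psi> V ?D" unfolding \<psi>_def by (rule bij_betw_the_inv_into[OF bij])
  have \<psi>D: "\<psi> v \<in> ?D" and \<phi>\<psi>: "\<phi> (\<psi> v) = v" if "v \<in> V" for v
    using that bij' f_the_inv_into_f_bij_betw[OF bij] by (auto simp: \<psi>_def bij_betw_def)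
  have \<psi>\<phi>: "\<psi> (\<phi> x) = x" if "x \<in> ?D" for x
    using that bij unfolding \<psi>_def by (simp add: bij_betw_def the_inv_into_f_f)
  define p where "p = pos \<circ> \<psi>"
  \<comment> \<open>The end that the edge leaves horizontally gives the bend its height, the other
    end its \<open>x\<close>-coordinate.\<close>
  define bp where "bp u v = (if hedge (\<psi> u) (\<psi> v) then (fst (p v), snd (p u)) else (fst (p u), snd (p v)))" for u v
  have adjV: "u \<in> V" "v \<in> V" "\<psi> u \<in> ?D" "\<psi> v \<in> ?D" "hedge (\<psi> u) (\<psi> v) \<or> hedge (\<psi> v) (\<psi> u)"
    if "adj E u v" for u v
    using adj_in_vertices[OF simple that] \<psi>D edge[of "\<psi> u" "\<psi> v"] \<phi>\<psi> that by auto
  have curve: "\<exists>x y. x \<in> ?D \<and> y \<in> ?D \<and> hedge x y \<and> \<psi> ` {u, v} = {x, y} \<and> edge_curve p bp u v = hv_curve (pos x) (pos y)"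
    if a: "adj E u v" for u v
  proof (cases "hedge (\<psi> u) (\<psi> v)")
    case True
    then show ?thesis using adjV[OF a]
      by (intro exI[of _ "\<psi> u"] exI[of _ "\<psi> v"]) (simp add: edge_curve_def hv_curve_def bp_def p_def)
  next
    case False
    then show ?thesis using adjV[OF a]
      by (intro exI[of _ "\<psi> v"] exI[of _ "\<psi> u"])
        (simp add: edge_curve_def hv_curve_def bp_def p_def insert_commute Un_commute closed_segment_commute)
  qed
  have inj: "inj_on \<psi> V" using bij' by (simp add: bij_betw_def)
  have "planar_L_drawing V E rot P p bp"
    unfolding planar_L_drawing_def
  proof (intro conjI allI impI ballI)
    show "inj_on p V" unfolding p_def
      using bij' inj_on_pos by (auto simp: bij_betw_def intro: comp_inj_on)
    show "p ` V \<subseteq> P" using P \<psi>D by (auto simp: p_def)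
  next
    fix u v assume a: "adj E u v"
    show "bp u v = bp v u"
      using adjV(5)[OF a] hedge_asym unfolding bp_def by metis
  next
    fix u v show "bp u v \<in> {(fst (p u), snd (p v)), (fst (p v), snd (p u))}" by (simp add: bp_def)
  next
    fix u v w z assume a: "adj E u v" "adj E w z" and ne: "{u, v} \<noteq> {w, z}"
    obtain x y where x: "x \<in> ?D" "y \<in> ?D" "hedge x y" "\<psi> ` {u, v} = {x, y}"
      "edge_curve p bp u v = hv_curve (pos x) (pos y)" using curve[OF a(1)] by blast
    obtain x' y' where x': "x' \<in> ?D" "y' \<in> ?D" "hedge x' y'" "\<psi> ` {w, z} = {x', y'}"
      "edge_curve p bp w z = hv_curve (pos x') (pos y')" using curve[OF a(2)] by blast
    have sub: "{u, v} \<subseteq> V" "{w, z} \<subseteq> V" using adjV a by auto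
    have ne': "{x, y} \<noteq> {x', y'}"
      using ne inj_on_image_eq_iff[OF inj sub] unfolding x(4) x'(4) by simp
    have "p ` ({u, v} \<inter> {w, z}) = pos ` ({x, y} \<inter> {x', y'})"
      using inj_on_image_Int[OF inj sub] x(4) x'(4) unfolding p_def by (metis image_comp)
    then show "edge_curve p bp u v \<inter> edge_curve p bp w z \<subseteq> p ` ({u, v} \<inter> {w, z})"
      using hv_curves_disjoint[OF x(3,1,2) x'(3,1,2) ne'] x(5) x'(5) by auto
  next
    fix v assume v: "v \<in> V"
    obtain i r where ir: "\<psi> v = (i, r)" "i < k" "v = \<phi> (i, r)"
      using \<psi>D[OF v] \<phi>\<psi>[OF v] by (metis SigmaD1 lessThan_iff surj_pair)
    show "\<exists>n. sorted_wrt (<) (map (port_dir p bp v) (rotate n (rot v)))"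
    proof (cases "r = Spine")
      case False
      then have "length (rot v) = 1" using leaf ir by simp
      then obtain a where "rot v = [a]" by (auto simp: length_Suc_conv)
      then show ?thesis by (intro exI[of _ 0]) simp
    next
      case True
      obtain m where m: "rotate m (rot v) = map \<phi> (spine_star k i)" using star ir True by blast
      obtain n where n: "sorted_wrt (<) (map (port (i, Spine)) (rotate n (spine_star k i)))"
        using ports_sorted[OF ir(2)] by blast
      have "port_dir p bp v (\<phi> y) = port (i, Spine) y" if "y \<in> set (spine_star k i)" for y
      proof -
        have y: "y \<in> ?D" using that spine_star_subset[OF ir(2)] by blast
        show ?thesis
          using fst_neq_if_hedge_Spine[OF _ ir(2) y]
          by (auto simp: port_dir_def bp_def p_def port_def ir(1) True \<psi>\<phi>[OF y] Let_def)
      qed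
      then have "map (port_dir p bp v) (map \<phi> (rotate n (spine_star k i))) =
          map (port (i, Spine)) (rotate n (spine_star k i))" by simp
      moreover have "rotate (n + m) (rot v) = map \<phi> (rotate n (spine_star k i))"
        using m by (simp flip: rotate_rotate add: rotate_map)
      ultimately show ?thesis using n by metis
    qed
  qed
  then show ?thesis by blast
qed

end

text \<open>This is the index layout with \<open>L = k\<close>, where
  \<open>3 * (16 * L + 1)\<close> is \<open>48 * k + 3\<close>. As \<open>q\<close> lists the points
  by \<open>x\<close>, comparisons of indices become comparisons of
  \<open>x\<close>-coordinates.\<close>

lemma exists_caterpillar_layout:
  assumes "finite P" "general_orthogonal_position P" "card P \<ge> 48 * k + 3"
  shows "\<exists>pos lo hi. caterpillar_layout k pos lo hi \<and> pos ` ({..<k} \<times> UNIV) \<subseteq> P"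
proof -
  obtain q where q: "\<And>i. i < card P \<Longrightarrow> q i \<in> P"
      "\<And>i j. i < j \<Longrightarrow> j < card P \<Longrightarrow> fst (q i) < fst (q j)"
      "inj_on (\<lambda>i. snd (q i)) {..<card P}"
    using enumerate_by_x[OF assms(1,2)] by blast
  have mono: "fst (q i) \<le> fst (q j)" if "i \<le> j" "j < card P" for i j
    using q(2)[of i j] that by (cases "i = j") auto
  obtain idx lo hi where
      "\<forall>i<k. \<forall>r. lo i \<le> idx (i, r) \<and> idx (i, r) \<le> hi i \<and> hi i < card P"
      "\<forall>i j. i < j \<longrightarrow> j < k \<longrightarrow> hi i < (lo j :: nat)"
      "\<forall>i<k. even i \<longrightarrow> snd (q (idx (i, First))) < snd (q (idx (i, Spine))) \<and>
        snd (q (idx (i, Spine))) < snd (q (idx (i, Second)))"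
      "\<forall>i<k. odd i \<longrightarrow> vertical_passage idx ((\<lambda>i. snd (q i)) \<circ> idx) i"
    using exists_index_layout[OF q(3), of k k] assms(3) by auto
  note idx = this[rule_format]
  have lt: "fst (q (idx (i, r))) < fst (q (idx (i, s)))" if "i < k" "idx (i, r) < idx (i, s)" for i r s
    using q(2)[OF that(2)] idx(1)[OF that(1), of s] by simp
  have "caterpillar_layout k (q \<circ> idx) (\<lambda>i. fst (q (lo i))) (\<lambda>i. fst (q (hi i)))"
  proof
    fix i r assume i: "i < k"
    show "fst (q (lo i)) \<le> fst ((q \<circ> idx) (i, r)) \<and> fst ((q \<circ> idx) (i, r)) \<le> fst (q (hi i))"
      using idx(1)[OF i, of r] mono by simp
  next
    fix i j assume ij: "i < j" "j < k"
    then show "fst (q (hi i)) < fst (q (lo j))"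
      using idx(2)[OF ij] idx(1)[OF ij(2), of Spine] q(2) by simp
  next
    fix i assume "i < k" "even i"
    then show "snd ((q \<circ> idx) (i, First)) < snd ((q \<circ> idx) (i, Spine)) \<and>
        snd ((q \<circ> idx) (i, Spine)) < snd ((q \<circ> idx) (i, Second))"
      using idx(3) by simp
  next
    fix i assume i: "i < k" "odd i"
    show "vertical_passage (fst \<circ> (q \<circ> idx)) (snd \<circ> (q \<circ> idx)) i"
      using idx(4)[OF i] lt[OF i(1)] unfolding vertical_passage_def by (elim disjE) simp_all
  qed
  moreover have "(q \<circ> idx) ` ({..<k} \<times> UNIV) \<subseteq> P"
  proof
    fix z assume "z \<in> (q \<circ> idx) ` ({..<k} \<times> UNIV)"
    then obtain i r where z: "i < k" "z = q (idx (i, r))" by auto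
    then show "z \<in> P" using idx(1)[OF z(1), of r] q(1) by simp
  qed
  ultimately show ?thesis by blast
qed

theorem theorem2:
  shows "\<exists>c::real. c > 0 \<and>
    (\<forall>n::nat. n \<ge> 2 \<longrightarrow>
      (\<forall>V E rot. top_view_caterpillar V E rot \<and> card V = n \<longrightarrow>
        (\<forall>P. finite P \<and> general_orthogonal_position P \<and> real (card P) \<ge> c * real n * ln (real n) \<longrightarrow>
          (\<exists>p bp. planar_L_drawing V E rot P p bp))))"
\<comment> \<open>Since \<open>ln n \<ge> 2 / 3\<close> for \<open>n \<ge> 2\<close>, the bound
  exceeds \<open>66 * n\<close>, which is at least \<open>48 * k + 3\<close> because
  \<open>k \<le> n\<close>.\<close>
proof (rule exI[of _ 100], intro conjI allI impI; (elim conjE)?)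
  fix n :: nat and V E rot P
  assume n: "2 \<le> n" and tv: "top_view_caterpillar V E rot" and V: "card V = n"
    and P: "finite P" "general_orthogonal_position P" "100 * real n * ln (real n) \<le> real (card P)"
  obtain k \<phi> where \<phi>: "bij_betw \<phi> ({..<k} \<times> UNIV) V"
    and edge: "\<And>x y. x \<in> {..<k} \<times> UNIV \<Longrightarrow> y \<in> {..<k} \<times> UNIV \<Longrightarrow> adj E (\<phi> x) (\<phi> y) \<Longrightarrow> hedge x y \<or> hedge y x"
    and star: "\<And>i. i < k \<Longrightarrow> \<exists>m. rotate m (rot (\<phi> (i, Spine))) = map \<phi> (spine_star k i)"
    and leaf: "\<And>i r. i < k \<Longrightarrow> r \<noteq> Spine \<Longrightarrow> length (rot (\<phi> (i, r))) = 1"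
    by (rule top_view_caterpillar_structure[OF tv]) (rule that; assumption)
  have simple: "simple_graph V E"
    using tv by (simp add: top_view_caterpillar_def caterpillar_def is_tree_def)
  have "r \<in> {Spine, First, Second}" for r by (cases r) auto
  then have "finite (UNIV :: role set)" by (metis UNIV_eq_I finite.simps)
  then have "1 \<le> card (UNIV :: role set)" by (simp add: Suc_le_eq card_gt_0_iff)
  moreover have "k * card (UNIV :: role set) = n"
    using bij_betw_same_card[OF \<phi>] V by (simp add: card_cartesian_product)
  ultimately have "k \<le> n" by (metis mult.right_neutral mult_le_mono2)
  have "2 / 3 \<le> ln (real n)"
    using ln2_ge_two_thirds n ln_le_cancel_iff[of 2 "real n"] by linarith
  then have "100 * real n * (2 / 3) \<le> 100 * real n * ln (real n)"
    by (intro mult_left_mono) simp_all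
  then have "card P \<ge> 48 * k + 3" using P(3) n \<open>k \<le> n\<close> by linarith
  then obtain pos lo hi where pos: "caterpillar_layout k pos lo hi" "pos ` ({..<k} \<times> UNIV) \<subseteq> P"
    using exists_caterpillar_layout P(1,2) by blast
  then interpret caterpillar_layout k pos lo hi by simp
  show "\<exists>p bp. planar_L_drawing V E rot P p bp"
    by (rule planar_L_drawing_exists[OF simple pos(2) \<phi> edge star leaf])
qed simp

end
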